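(* Let $\{P_{u,b}\}_{u\in\mathcal U,\,b\in B_u}$ be a measurement setting family on $\mathcal H=(\mathbb C^2)^{\otimes n}$, let $O=|\psi\rangle\langle\psi|$ with $|\psi\rangle\in\mathcal H$ a unit vector, and let $$\Gamma^\star(O)=\inf_{(q,\alpha)\ \text{admissible}}\ \sup_{\rho}\operatorname{Var}_\rho(X),$$ where $X$ is the one-shot estimator corresponding to $(q,\alpha)$ and $\rho$ ranges over all density operators on $\mathcal H$. Then $\Gamma^\star(O)$ equals the optimum of the semidefinite program, in real variables $\alpha=(\alpha_{u,b})$, $q=(q(u))$, $y=(y_{u,b})$, $t,\gamma,s$, $$\begin{aligned} \min_{\alpha,q,y,t,\gamma,s}\quad & \gamma+s\\ \text{s.t.}\quad & \sum_{u,b}\alpha_{u,b}P_{u,b}=O,\\ & q(u)\ge 0\quad (u\in\mathcal U),\qquad \sum_{u\in\mathcal U}q(u)=1,\\ & \begin{bmatrix}y_{u,b} & \alpha_{u,b}\\ \alpha_{u,b} & q(u)\end{bmatrix}\succeq 0\quad (u\in\mathcal U,\ b\in B_u),\\ & \sum_{u,b}y_{u,b}P_{u,b}-2tO\preceq \gamma I,\\ & \begin{bmatrix}s & t\\ t & 1\end{bmatrix}\succeq 0 . \end{aligned}$$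
   Context: $\mathcal H=(\mathbb C^2)^{\otimes n}$ is the $n$-qubit Hilbert space. A density operator (state) is an operator $\rho\succeq0$ on $\mathcal H$ with $\operatorname{tr}(\rho)=1$. $A\preceq B$ means $B-A$ is positive semidefinite. A measurement setting family is a finite collection of operators $P_{u,b}\succeq 0$ on $\mathcal H$, indexed by settings $u\in\mathcal U$ and outcomes $b\in B_u$ (finite sets), such that $\sum_{b\in B_u}P_{u,b}=I$ for each $u\in\mathcal U$. An admissible pair $(q,\alpha)$ for $O$ consists of a probability distribution $q$ on $\mathcal U$ and real numbers $\alpha_{u,b}$ ($u\in\mathcal U$, $b\in B_u$) such that $\alpha_{u,b}=0$ for all $b\in B_u$ whenever $q(u)=0$, and $\sum_{u,b}\alpha_{u,b}P_{u,b}=O$ (the unbiasedness identity). The one-shot estimator corresponding to $(q,\alpha)$: when the state is $\rho$, sample $u$ from $q$, then obtain outcome $b\in B_u$ with probability $\operatorname{tr}(\rho P_{u,b})$, and output $X=\alpha_{u,b}/q(u)$. $\operatorname{Var}_\rho(X)$ is the variance of $X$ under this procedure. The optimum of the program is its optimal value; if there are no feasible points (equivalently no admissible pairs), both sides are $+\infty$ by convention. *)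

theory Defs
  imports
    "HOL-Probability.Probability_Mass_Function"
    "Jordan_Normal_Form.Schur_Decomposition"
begin

unbundle no vec_syntax
hide_const (open) Finite_Cartesian_Product.vec Finite_Cartesian_Product.mat

text \<open>Throughout, \<open>(\<complex>\<^sup>2)\<^sup>\<otimes>\<^sup>n\<close> is identified with \<open>\<complex>\<close>-vectors of length
  \<open>2 ^ n\<close> via the computational basis, and operators with square complex matrices.\<close>

definition mat_trace :: "'a :: comm_monoid_add mat \<Rightarrow> 'a" where
  "mat_trace A = (\<Sum>i<dim_row A. A $$ (i, i))"

text \<open>Over \<^typ>\<open>complex\<close>, \<open>0 \<le> z\<close> means that \<open>z\<close> is a nonnegative real.\<close>

definition psd :: "nat \<Rightarrow> 'a :: conjugatable_ordered_field mat \<Rightarrow> bool" where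
  "psd d A \<longleftrightarrow> A \<in> carrier_mat d d \<and> mat_adjoint A = A
    \<and> (\<forall>v \<in> carrier_vec d. 0 \<le> (A *\<^sub>v v) \<bullet>c v)"

definition loewner_le :: "nat \<Rightarrow> complex mat \<Rightarrow> complex mat \<Rightarrow> bool" where
  "loewner_le d A B \<longleftrightarrow> A \<in> carrier_mat d d \<and> B \<in> carrier_mat d d \<and> psd d (B - A)"

definition density_ops :: "nat \<Rightarrow> complex mat set" where
  "density_ops d = {\<rho>. psd d \<rho> \<and> mat_trace \<rho> = 1}"

definition ket_bra :: "complex vec \<Rightarrow> complex vec \<Rightarrow> complex mat" where
  "ket_bra v w = mat (dim_vec v) (dim_vec w) (\<lambda>(i, j). v $ i * cnj (w $ j))"

text \<open>The sum of a family of \<open>d \<times> d\<close> matrices; the dimension is explicit since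
  \<^typ>\<open>complex mat\<close> has no zero element that would be the value of an empty sum.\<close>

definition mat_sum :: "nat \<Rightarrow> ('i \<Rightarrow> complex mat) \<Rightarrow> 'i set \<Rightarrow> complex mat" where
  "mat_sum d F I = mat d d (\<lambda>ij. \<Sum>k\<in>I. F k $$ ij)"

definition measurement_family ::
  "nat \<Rightarrow> 'u set \<Rightarrow> ('u \<Rightarrow> 'b set) \<Rightarrow> ('u \<Rightarrow> 'b \<Rightarrow> complex mat) \<Rightarrow> bool" where
  "measurement_family n U B P \<longleftrightarrow> finite U \<and>
    (\<forall>u\<in>U. finite (B u) \<and> (\<forall>b\<in>B u. psd (2 ^ n) (P u b))
       \<and> mat_sum (2 ^ n) (P u) (B u) = 1\<^sub>m (2 ^ n))"

definition weighted_effects ::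
  "nat \<Rightarrow> 'u set \<Rightarrow> ('u \<Rightarrow> 'b set) \<Rightarrow> ('u \<Rightarrow> 'b \<Rightarrow> complex mat) \<Rightarrow> ('u \<Rightarrow> 'b \<Rightarrow> real)
    \<Rightarrow> complex mat" where
  "weighted_effects n U B P c =
     mat_sum (2 ^ n) (\<lambda>(u, b). complex_of_real (c u b) \<cdot>\<^sub>m P u b) (SIGMA u:U. B u)"

definition admissible ::
  "nat \<Rightarrow> 'u set \<Rightarrow> ('u \<Rightarrow> 'b set) \<Rightarrow> ('u \<Rightarrow> 'b \<Rightarrow> complex mat) \<Rightarrow> complex mat
    \<Rightarrow> 'u pmf \<Rightarrow> ('u \<Rightarrow> 'b \<Rightarrow> real) \<Rightarrow> bool" where
  "admissible n U B P Obs q \<alpha> \<longleftrightarrow> set_pmf q \<subseteq> U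
    \<and> (\<forall>u\<in>U. pmf q u = 0 \<longrightarrow> (\<forall>b\<in>B u. \<alpha> u b = 0))
    \<and> weighted_effects n U B P \<alpha> = Obs"

text \<open>The Born rule. For a density operator and a measurement family the numbers below are
  nonnegative and sum to 1, so that the use of \<^const>\<open>embed_pmf\<close> is legitimate.\<close>

definition outcome_pmf ::
  "('u \<Rightarrow> 'b set) \<Rightarrow> ('u \<Rightarrow> 'b \<Rightarrow> complex mat) \<Rightarrow> complex mat \<Rightarrow> 'u \<Rightarrow> 'b pmf" where
  "outcome_pmf B P \<rho> u =
     embed_pmf (\<lambda>b. if b \<in> B u then Re (mat_trace (\<rho> * P u b)) else 0)"

definition sampling_pmf ::
  "('u \<Rightarrow> 'b set) \<Rightarrow> ('u \<Rightarrow> 'b \<Rightarrow> complex mat) \<Rightarrow> 'u pmf \<Rightarrow> complex mat \<Rightarrow> ('u \<times> 'b) pmf" where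
  "sampling_pmf B P q \<rho> =
     bind_pmf q (\<lambda>u. map_pmf (\<lambda>b. (u, b)) (outcome_pmf B P \<rho> u))"

definition one_shot_estimator :: "'u pmf \<Rightarrow> ('u \<Rightarrow> 'b \<Rightarrow> real) \<Rightarrow> 'u \<times> 'b \<Rightarrow> real" where
  "one_shot_estimator q \<alpha> = (\<lambda>(u, b). \<alpha> u b / pmf q u)"

definition one_shot_variance ::
  "('u \<Rightarrow> 'b set) \<Rightarrow> ('u \<Rightarrow> 'b \<Rightarrow> complex mat) \<Rightarrow> 'u pmf \<Rightarrow> ('u \<Rightarrow> 'b \<Rightarrow> real) \<Rightarrow> complex mat
    \<Rightarrow> real" where
  "one_shot_variance B P q \<alpha> \<rho> =
     measure_pmf.variance (sampling_pmf B P q \<rho>) (one_shot_estimator q \<alpha>)"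

text \<open>Both optimal values are taken in \<^typ>\<open>ereal\<close>, where the infimum of the empty set is \<open>\<infinity>\<close>.\<close>

definition Gamma_star ::
  "nat \<Rightarrow> 'u set \<Rightarrow> ('u \<Rightarrow> 'b set) \<Rightarrow> ('u \<Rightarrow> 'b \<Rightarrow> complex mat) \<Rightarrow> complex mat \<Rightarrow> ereal" where
  "Gamma_star n U B P Obs =
     (INF (q, \<alpha>) \<in> {(q, \<alpha>). admissible n U B P Obs q \<alpha>}.
        SUP \<rho> \<in> density_ops (2 ^ n). ereal (one_shot_variance B P q \<alpha> \<rho>))"

definition sdp_feasible ::
  "nat \<Rightarrow> 'u set \<Rightarrow> ('u \<Rightarrow> 'b set) \<Rightarrow> ('u \<Rightarrow> 'b \<Rightarrow> complex mat) \<Rightarrow> complex mat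
    \<Rightarrow> ('u \<Rightarrow> 'b \<Rightarrow> real) \<Rightarrow> ('u \<Rightarrow> real) \<Rightarrow> ('u \<Rightarrow> 'b \<Rightarrow> real) \<Rightarrow> real \<Rightarrow> real \<Rightarrow> real \<Rightarrow> bool" where
  "sdp_feasible n U B P Obs \<alpha> q y t \<gamma> s \<longleftrightarrow>
     weighted_effects n U B P \<alpha> = Obs
   \<and> (\<forall>u\<in>U. q u \<ge> 0) \<and> (\<Sum>u\<in>U. q u) = 1
   \<and> (\<forall>u\<in>U. \<forall>b\<in>B u. psd 2 (mat_of_rows_list 2 [[y u b, \<alpha> u b], [\<alpha> u b, q u]]))
   \<and> loewner_le (2 ^ n)
       (weighted_effects n U B P y - complex_of_real (2 * t) \<cdot>\<^sub>m Obs)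
       (complex_of_real \<gamma> \<cdot>\<^sub>m 1\<^sub>m (2 ^ n))
   \<and> psd 2 (mat_of_rows_list 2 [[s, t], [t, 1]])"

definition sdp_optimum ::
  "nat \<Rightarrow> 'u set \<Rightarrow> ('u \<Rightarrow> 'b set) \<Rightarrow> ('u \<Rightarrow> 'b \<Rightarrow> complex mat) \<Rightarrow> complex mat \<Rightarrow> ereal" where
  "sdp_optimum n U B P Obs =
     (INF (\<alpha>, q, y, t, \<gamma>, s) \<in> {(\<alpha>, q, y, t, \<gamma>, s). sdp_feasible n U B P Obs \<alpha> q y t \<gamma> s}.
        ereal (\<gamma> + s))"

end

theory Submission
  imports Defs
begin

text \<open>With \<open>x = tr (\<rho> O)\<close> and \<open>M = \<Sum> (\<alpha>\<^sub>u\<^sub>b)\<^sup>2 / q(u) P\<^sub>u\<^sub>b\<close> the variance is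
  \<open>tr (\<rho> M) - x\<^sup>2 = min\<^sub>t tr (\<rho> (M - 2 t O)) + t\<^sup>2\<close>. Exchanging the maximum over \<open>\<rho>\<close> with the
  minimum over \<open>t\<close> leaves the largest eigenvalue \<open>\<gamma>\<close> of \<open>M - 2 t O\<close> plus \<open>s = t\<^sup>2\<close>; the variables \<open>y\<close>
  linearise the quotients \<open>\<alpha>\<^sup>2 / q\<close>.\<close>

subsection \<open>Positive semidefinite matrices and the trace pairing\<close>

text \<open>No minimax theorem is used for the exchange. For a fixed admissible pair, an approximate
  maximiser \<open>\<rho>0\<close> itself dictates \<open>t = tr (\<rho>0 O)\<close>, because
  \<open>t\<^sup>2 - 2 t x\<close> attains its minimum \<open>- x\<^sup>2\<close> at
  \<open>t = x\<close>. At an exact maximiser first-order optimality would be the operator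
  inequality; at an approximate one a second-order term survives. It is bounded through
  \<open>0 \<le> tr (\<rho> O) \<le> 1\<close>, which is where the rank-one projector enters.
  Eigenvalues do not appear either: positivity of a Hermitian operator is tested by its trace
  against all density operators. One half of this test is the self-duality of the positive
  semidefinite cone, obtained by Cholesky elimination instead of a spectral decomposition; the other
  half needs only rank-one states.\<close>

lemma quadratic_form_sum:
  assumes "A \<in> carrier_mat d d" "v \<in> carrier_vec d" "w \<in> carrier_vec d"
  shows "(A *\<^sub>v v) \<bullet>c w = (\<Sum>i<d. \<Sum>j<d. A $$ (i, j) * v $ j * conjugate (w $ i))"
  using assms
  by (auto simp: scalar_prod_def lessThan_atLeast0 sum_distrib_right intro!: sum.cong)

text \<open>Polymorphic because \<open>psd\<close> is applied both to complex operators and to the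
  real two-by-two blocks of the program.\<close>

lemma mat_adjoint_eq_iff:
  assumes "A \<in> carrier_mat d d"
  shows "mat_adjoint A = A \<longleftrightarrow> (\<forall>i<d. \<forall>j<d. conjugate (A $$ (j, i)) = A $$ (i, j))"
proof -
  have "mat_adjoint A = mat d d (\<lambda>(i, j). conjugate (A $$ (j, i)))"
    using assms by (intro eq_matI) (auto simp: mat_adjoint_def mat_of_rows_def)
  moreover have "mat d d (\<lambda>(i, j). conjugate (A $$ (j, i))) = A
      \<longleftrightarrow> (\<forall>i<d. \<forall>j<d. mat d d (\<lambda>(i, j). conjugate (A $$ (j, i))) $$ (i, j) = A $$ (i, j))"
    using assms by (auto intro!: eq_matI simp del: index_mat)
  ultimately show ?thesis
    by simp
qed

text \<open>The form of a Hermitian matrix equals its own conjugate, so the complex order reduces to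
  a condition on real parts. Testing with functions instead of vectors removes the carrier side
  conditions.\<close>

lemma psd_entries:
  fixes A :: "complex mat"
  shows "psd d A \<longleftrightarrow> A \<in> carrier_mat d d \<and> (\<forall>i<d. \<forall>j<d. cnj (A $$ (j, i)) = A $$ (i, j))
    \<and> (\<forall>f. 0 \<le> Re (\<Sum>i<d. \<Sum>j<d. A $$ (i, j) * f j * cnj (f i)))"
proof (cases "A \<in> carrier_mat d d \<and> (\<forall>i<d. \<forall>j<d. cnj (A $$ (j, i)) = A $$ (i, j))")
  case False
  then show ?thesis by (auto simp: psd_def mat_adjoint_eq_iff)
next
  case True
  then have A: "A \<in> carrier_mat d d" and herm: "\<And>i j. i < d \<Longrightarrow> j < d \<Longrightarrow> cnj (A $$ (j, i)) = A $$ (i, j)"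
    by auto
  define Q where "Q f = (\<Sum>i<d. \<Sum>j<d. A $$ (i, j) * f j * cnj (f i))" for f :: "nat \<Rightarrow> complex"
  have "cnj (Q f) = Q f" for f
  proof -
    have "cnj (Q f) = (\<Sum>i<d. \<Sum>j<d. A $$ (j, i) * f i * cnj (f j))"
      unfolding Q_def cnj_sum
      by (intro sum.cong refl) (simp add: herm)
    also have "\<dots> = Q f"
      unfolding Q_def by (rule sum.swap)
    finally show ?thesis .
  qed
  then have "Im (Q f) = 0" for f
    by (metis Reals_cnj_iff complex_is_Real_iff)
  then have real: "0 \<le> Q f \<longleftrightarrow> 0 \<le> Re (Q f)" for f
    by (simp add: less_eq_complex_def)
  have "(\<forall>v \<in> carrier_vec d. 0 \<le> (A *\<^sub>v v) \<bullet>c v) \<longleftrightarrow> (\<forall>f. 0 \<le> Q f)"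
  proof safe
    fix f assume *: "\<forall>v \<in> carrier_vec d. 0 \<le> (A *\<^sub>v v) \<bullet>c v"
    have "(A *\<^sub>v vec d f) \<bullet>c vec d f = Q f"
      unfolding Q_def by (subst quadratic_form_sum[OF A]) (auto intro!: sum.cong)
    then show "0 \<le> Q f" using *[rule_format, of "vec d f"] by simp
  next
    fix v :: "complex vec" assume *: "\<forall>f. 0 \<le> Q f" and v: "v \<in> carrier_vec d"
    have "(A *\<^sub>v v) \<bullet>c v = Q (($) v)"
      unfolding Q_def using v by (subst quadratic_form_sum[OF A]) auto
    then show "0 \<le> (A *\<^sub>v v) \<bullet>c v" using * by simp
  qed
  then show ?thesis
    using True real by (auto simp: psd_def mat_adjoint_eq_iff Q_def)
qed

lemma psd_form_nonneg:
  fixes A :: "complex mat"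
  shows "psd d A \<Longrightarrow> 0 \<le> Re (\<Sum>i<d. \<Sum>j<d. A $$ (i, j) * f j * cnj (f i))"
  by (simp add: psd_entries)

text \<open>The Hilbert-Schmidt inner product on Hermitian matrices. Taking the real part gives a
  real-linear functional without a proof that the trace is real, and matches the Born rule in
  \<open>outcome_pmf\<close>.\<close>

definition trace_pairing :: "complex mat \<Rightarrow> complex mat \<Rightarrow> real" where
  "trace_pairing A C = Re (mat_trace (A * C))"

lemma mat_trace_mult:
  assumes "A \<in> carrier_mat d d" "C \<in> carrier_mat d d"
  shows "mat_trace (A * C) = (\<Sum>i<d. \<Sum>j<d. A $$ (i, j) * C $$ (j, i))"
  using assms by (auto simp: mat_trace_def scalar_prod_def lessThan_atLeast0 intro!: sum.cong)

text \<open>The form at \<open>f + c e_k\<close>, with \<open>e_k\<close> the k-th unit vector. Each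
  later use is one well-chosen \<open>c\<close>.\<close>

lemma sum_form_perturb:
  fixes f :: "nat \<Rightarrow> complex"
  assumes "k < d"
  shows "(\<Sum>i<d. \<Sum>j<d. a i j * (f j + (if j = k then c else 0)) * cnj (f i + (if i = k then c else 0)))
    = (\<Sum>i<d. \<Sum>j<d. a i j * f j * cnj (f i)) + cnj c * (\<Sum>j<d. a k j * f j)
      + c * (\<Sum>i<d. a i k * cnj (f i)) + a k k * c * cnj c"
proof -
  have "(\<Sum>i<d. \<Sum>j<d. a i j * (f j + (if j = k then c else 0)) * cnj (f i + (if i = k then c else 0)))
    = (\<Sum>i<d. \<Sum>j<d. a i j * f j * cnj (f i) + (if i = k then cnj c * (a k j * f j) else 0)
        + (if j = k then c * (a i k * cnj (f i)) else 0) + (if j = k then (if i = k then a k k * c * cnj c else 0) else 0))"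
    by (intro sum.cong refl) (simp add: algebra_simps)
  also have "\<dots> = (\<Sum>i<d. (\<Sum>j<d. a i j * f j * cnj (f i)) + (if i = k then cnj c * (\<Sum>j<d. a k j * f j) else 0)
        + c * (a i k * cnj (f i)) + (if i = k then a k k * c * cnj c else 0))"
    using assms by (intro sum.cong refl) (simp add: sum.distrib sum_distrib_left split: if_split)
  also have "\<dots> = (\<Sum>i<d. \<Sum>j<d. a i j * f j * cnj (f i)) + cnj c * (\<Sum>j<d. a k j * f j)
      + c * (\<Sum>i<d. a i k * cnj (f i)) + a k k * c * cnj c"
    using assms by (simp add: sum.distrib sum_distrib_left)
  finally show ?thesis .
qed

lemma psd_diag:
  fixes A :: "complex mat"
  assumes "psd d A" "k < d"
  shows "A $$ (k, k) = complex_of_real (Re (A $$ (k, k)))" "0 \<le> Re (A $$ (k, k))"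
proof -
  have "A $$ (k, k) = cnj (A $$ (k, k))"
    using assms by (simp add: psd_entries)
  then show "A $$ (k, k) = complex_of_real (Re (A $$ (k, k)))"
    by (metis Reals_cnj_iff of_real_Re)
  \<comment> \<open>The idle \<open>0 +\<close> in the test function gives it the shape of
    \<open>sum_form_perturb\<close> with \<open>f = 0\<close> and \<open>c = 1\<close>.\<close>
  show "0 \<le> Re (A $$ (k, k))"
    using psd_form_nonneg[OF assms(1), of "\<lambda>i. 0 + (if i = k then 1 else 0)"]
    unfolding sum_form_perturb[OF assms(2), of "\<lambda>i j. A $$ (i, j)" "\<lambda>_. 0"] by simp
qed

text \<open>With a vanishing pivot, the form at \<open>e_j - r z e_k\<close> is affine in the real
  number \<open>r\<close> with slope \<open>- 2 |z|\<^sup>2\<close>, hence unbounded below unless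
  \<open>z = 0\<close>.\<close>

lemma psd_zero_diag_row:
  fixes A :: "complex mat"
  assumes psd: "psd d A" and k: "k < d" and j: "j < d" and zero: "A $$ (k, k) = 0"
  shows "A $$ (k, j) = 0"
proof (rule ccontr)
  assume nz: "A $$ (k, j) \<noteq> 0"
  define z where "z = A $$ (k, j)"
  have herm: "A $$ (j, k) = cnj z"
    using psd k j by (auto simp: psd_entries z_def)
  have "j \<noteq> k" using nz zero by auto
  define D where "D = Re (A $$ (j, j))"
  have *: "0 \<le> D - 2 * r * (cmod z)\<^sup>2" for r :: real
  proof -
    let ?e = "\<lambda>i. if i = j then 1 else 0 :: complex"
    have "(\<Sum>i<d. \<Sum>l<d. A $$ (i, l) * ?e l * cnj (?e i)) = A $$ (j, j)"
      using sum_form_perturb[OF j, of "\<lambda>i j. A $$ (i, j)" "\<lambda>_. 0" 1] by simp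
    moreover have "(\<Sum>l<d. A $$ (k, l) * ?e l) = (\<Sum>l<d. if l = j then z else 0)"
      "(\<Sum>i<d. A $$ (i, k) * cnj (?e i)) = (\<Sum>i<d. if i = j then cnj z else 0)"
      by (intro sum.cong refl; simp add: z_def herm)+
    moreover have "(\<Sum>l<d. if l = j then c else 0) = c" for c :: complex
      using j by simp
    ultimately have "0 \<le> Re (A $$ (j, j) + cnj (- (r * z)) * z + (- (r * z)) * cnj z)"
      using psd_form_nonneg[OF psd, of "\<lambda>i. ?e i + (if i = k then - (r * z) else 0)"]
      unfolding sum_form_perturb[OF k, of "\<lambda>i j. A $$ (i, j)" ?e] by (simp only: zero) simp
    then show ?thesis
      by (simp add: D_def cmod_def power2_eq_square algebra_simps)
  qed
  have "(cmod z)\<^sup>2 > 0" using nz by (simp add: z_def)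
  \<comment> \<open>This \<open>r\<close> makes the form equal to \<open>- 1\<close>.\<close>
  with *[of "(D + 1) / (2 * (cmod z)\<^sup>2)"] show False
    by simp
qed

text \<open>One step of the Cholesky decomposition. If the pivot \<open>A\<^sub>k\<^sub>k\<close> vanishes, so does its
  row, and the division by zero makes the subtracted term vanish.\<close>

lemma psd_schur_complement:
  fixes A :: "complex mat"
  assumes psd: "psd d A" and k: "k < d"
  defines "A' \<equiv> mat d d (\<lambda>(i, j). A $$ (i, j) - A $$ (i, k) * A $$ (k, j) / A $$ (k, k))"
  shows "psd d A'"
proof (cases "A $$ (k, k) = 0")
  case True
  have "A' = A"
    using psd by (intro eq_matI) (auto simp: A'_def True psd_entries)
  then show ?thesis using psd by simp
next
  case False
  define p where "p = Re (A $$ (k, k))"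
  have Akk: "A $$ (k, k) = complex_of_real p" and "p > 0"
    using psd_diag[OF psd k] False by (auto simp: p_def complex_eq_iff)
  have herm: "cnj (A $$ (j, i)) = A $$ (i, j)" if "i < d" "j < d" for i j
    using psd that by (auto simp: psd_entries)
  show ?thesis
    unfolding psd_entries
  proof (intro conjI allI impI)
    show "A' \<in> carrier_mat d d" by (simp add: A'_def)
    show "cnj (A' $$ (j, i)) = A' $$ (i, j)" if "i < d" "j < d" for i j
    proof -
      have "cnj (A $$ (j, i)) = A $$ (i, j)" "cnj (A $$ (j, k)) = A $$ (k, j)" "cnj (A $$ (k, i)) = A $$ (i, k)"
        using herm that k by metis+
      then show ?thesis
        using that by (simp add: A'_def Akk mult.commute)
    qed
    fix f :: "nat \<Rightarrow> complex"
    define z where "z = (\<Sum>j<d. A $$ (k, j) * f j)"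
    have z': "(\<Sum>i<d. A $$ (i, k) * cnj (f i)) = cnj z"
      unfolding z_def cnj_sum
      by (intro sum.cong refl) (simp add: herm k)
    \<comment> \<open>This \<open>c\<close> minimises the form of \<open>A\<close> at
      \<open>f + c e_k\<close>; completing the square shows the minimum to be the form of
      \<open>A'\<close> at \<open>f\<close>.\<close>
    define c where "c = - z / complex_of_real p"
    have "(\<Sum>i<d. \<Sum>j<d. A' $$ (i, j) * f j * cnj (f i))
      = (\<Sum>i<d. \<Sum>j<d. A $$ (i, j) * f j * cnj (f i))
        - (\<Sum>i<d. \<Sum>j<d. (A $$ (i, k) * cnj (f i)) * (A $$ (k, j) * f j)) / p"
      by (simp add: A'_def Akk sum_subtractf[symmetric] sum_divide_distrib field_simps)
    also have "(\<Sum>i<d. \<Sum>j<d. (A $$ (i, k) * cnj (f i)) * (A $$ (k, j) * f j)) = cnj z * z"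
      unfolding sum_product[symmetric] z' z_def[symmetric] ..
    finally have eq: "(\<Sum>i<d. \<Sum>j<d. A' $$ (i, j) * f j * cnj (f i))
      = (\<Sum>i<d. \<Sum>j<d. A $$ (i, j) * f j * cnj (f i)) - cnj z * z / p" .
    have "(\<Sum>i<d. \<Sum>j<d. A' $$ (i, j) * f j * cnj (f i))
      = (\<Sum>i<d. \<Sum>j<d. A $$ (i, j) * f j * cnj (f i)) + cnj c * z + c * cnj z + A $$ (k, k) * c * cnj c"
    proof -
      have "cnj c * z + c * cnj z + A $$ (k, k) * c * cnj c = - (cnj z * z / p)"
        using \<open>p > 0\<close> by (simp add: c_def Akk field_simps)
      then show ?thesis
        unfolding eq by (simp add: add.assoc)
    qed
    also have "\<dots> = (\<Sum>i<d. \<Sum>j<d. A $$ (i, j) * (f j + (if j = k then c else 0))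
        * cnj (f i + (if i = k then c else 0)))"
      unfolding sum_form_perturb[OF k, of "\<lambda>i j. A $$ (i, j)" f] z' z_def[symmetric] ..
    finally show "0 \<le> Re (\<Sum>i<d. \<Sum>j<d. A' $$ (i, j) * f j * cnj (f i))"
      by (simp only: psd_form_nonneg[OF psd])
  qed
qed

text \<open>Elimination peels off rank-one terms \<open>a a^H / p\<close>, with \<open>a\<close> a
  column of the current matrix and \<open>p\<close> its pivot. The trace of such a term against
  \<open>C\<close> is the form of \<open>C\<close> at \<open>a\<close> divided by \<open>p\<close>,
  which is nonnegative.\<close>

lemma trace_pairing_nonneg:
  assumes A: "psd d A" and C: "psd d C"
  shows "0 \<le> trace_pairing A C"
proof -
  have carr: "psd d A \<Longrightarrow> A \<in> carrier_mat d d" for A :: "complex mat" by (simp add: psd_def)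
  \<comment> \<open>Downward induction on the number \<open>k\<close> of rows already cleared: at
    \<open>k = d\<close> the matrix is zero, and one elimination leads from \<open>k\<close> to
    \<open>Suc k\<close>.\<close>
  have "0 \<le> trace_pairing A C"
    if "psd d A" "\<And>i j. i < k \<Longrightarrow> j < d \<Longrightarrow> A $$ (i, j) = 0" "k \<le> d" for k A
    using that(3,1,2)
  proof (induction k arbitrary: A rule: inc_induct)
    case base
    then show ?case
      using carr[OF base(1)] carr[OF C] by (simp add: trace_pairing_def mat_trace_mult)
  next
    case (step k)
    define A' where "A' = mat d d (\<lambda>(i, j). A $$ (i, j) - A $$ (i, k) * A $$ (k, j) / A $$ (k, k))"
    have psd': "psd d A'"
      unfolding A'_def using step.prems(1) step.hyps(2) by (rule psd_schur_complement)
    define p where "p = Re (A $$ (k, k))"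
    have Akk: "A $$ (k, k) = complex_of_real p" and p: "p \<ge> 0"
      using psd_diag[OF step.prems(1) step.hyps(2)] by (auto simp: p_def)
    have herm: "cnj (A $$ (j, i)) = A $$ (i, j)" if "i < d" "j < d" for i j
      using step.prems(1) that by (auto simp: psd_entries)
    have row: "cnj (A $$ (j, k)) = A $$ (k, j)" if "j < d" for j
      using that step.hyps(2) by (rule herm[rotated])
    have "0 \<le> trace_pairing A' C"
    proof (rule step.IH[OF psd'])
      fix i j assume ij: "i < Suc k" "j < d"
      \<comment> \<open>Row \<open>k\<close> cancels if the pivot is nonzero and was zero already
        otherwise. The rows above stay zero because their entry in column \<open>k\<close> is
        zero.\<close>
      show "A' $$ (i, j) = 0"
      proof (cases "i = k")
        case True
        then show ?thesis
          using ij step.hyps psd_zero_diag_row[OF step.prems(1) step.hyps(2) ij(2)] by (auto simp: A'_def)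
      next
        case False
        then show ?thesis
          using ij step.hyps step.prems(2) by (auto simp: A'_def)
      qed
    qed
    \<comment> \<open>For \<open>p = 0\<close> the quotient is zero by convention, in accordance
      with \<open>A' = A\<close>.\<close>
    moreover have "mat_trace (A * C) = mat_trace (A' * C)
        + (\<Sum>j<d. \<Sum>i<d. C $$ (j, i) * A $$ (i, k) * cnj (A $$ (j, k))) / p"
    proof -
      have "mat_trace (A * C) = (\<Sum>i<d. \<Sum>j<d. A' $$ (i, j) * C $$ (j, i)
          + C $$ (j, i) * A $$ (i, k) * cnj (A $$ (j, k)) / p)"
        using step.hyps(2)
        by (subst mat_trace_mult[OF carr[OF step.prems(1)] carr[OF C]])
          (auto simp: A'_def Akk row algebra_simps intro!: sum.cong)
      also have "\<dots> = mat_trace (A' * C) + (\<Sum>i<d. \<Sum>j<d. C $$ (j, i) * A $$ (i, k) * cnj (A $$ (j, k))) / p"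
        by (subst mat_trace_mult[OF carr[OF psd'] carr[OF C]])
          (simp add: sum.distrib sum_divide_distrib)
      finally show ?thesis
        by (subst sum.swap)
    qed
    ultimately show ?case
      using psd_form_nonneg[OF C, of "\<lambda>i. A $$ (i, k)"] p
      by (simp add: trace_pairing_def)
  qed
  from this[of A 0] A show ?thesis by simp
qed

section \<open>Real linearity of the trace pairing\<close>

lemma trace_pairing_sum:
  assumes "A \<in> carrier_mat d d" "C \<in> carrier_mat d d"
  shows "trace_pairing A C = (\<Sum>i<d. \<Sum>j<d. Re (A $$ (i, j) * C $$ (j, i)))"
  unfolding trace_pairing_def mat_trace_mult[OF assms] Re_sum ..

lemma trace_pairing_one:
  assumes "A \<in> carrier_mat d d"
  shows "trace_pairing A (1\<^sub>m d) = Re (mat_trace A)"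
  using assms by (simp add: trace_pairing_def)

lemma trace_pairing_diff_right:
  assumes "A \<in> carrier_mat d d" "C \<in> carrier_mat d d" "D \<in> carrier_mat d d"
  shows "trace_pairing A (C - D) = trace_pairing A C - trace_pairing A D"
  using assms
  by (simp add: trace_pairing_def mult_minus_distrib_mat mat_trace_def sum_subtractf[of _ _ "{..<d}"]
    del: index_mult_mat(1))

lemma trace_pairing_smult_right:
  assumes "A \<in> carrier_mat d d" "C \<in> carrier_mat d d"
  shows "trace_pairing A (complex_of_real c \<cdot>\<^sub>m C) = c * trace_pairing A C"
  using assms
  by (simp add: trace_pairing_def mult_smult_distrib mat_trace_def sum_distrib_left
    del: index_mult_mat(1))

lemma trace_pairing_add_left:
  assumes "A \<in> carrier_mat d d" "A' \<in> carrier_mat d d" "C \<in> carrier_mat d d"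
  shows "trace_pairing (A + A') C = trace_pairing A C + trace_pairing A' C"
  using assms
  by (simp add: trace_pairing_def add_mult_distrib_mat mat_trace_def sum.distrib
    del: index_mult_mat(1))

lemma trace_pairing_smult_left:
  assumes "A \<in> carrier_mat d d" "C \<in> carrier_mat d d"
  shows "trace_pairing (complex_of_real c \<cdot>\<^sub>m A) C = c * trace_pairing A C"
  using assms
  by (simp add: trace_pairing_def mult_smult_assoc_mat mat_trace_def sum_distrib_left
    del: index_mult_mat(1))

section \<open>Density operators, rank-one states and positivity tests\<close>

lemma density_ops_carrier: "\<rho> \<in> density_ops d \<Longrightarrow> \<rho> \<in> carrier_mat d d"
  by (simp add: density_ops_def psd_def)

lemma density_ops_convex:
  assumes \<rho>: "\<rho> \<in> density_ops d" "\<sigma> \<in> density_ops d" and l: "0 \<le> l" "l \<le> (1::real)"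
  shows "complex_of_real (1 - l) \<cdot>\<^sub>m \<rho> + complex_of_real l \<cdot>\<^sub>m \<sigma> \<in> density_ops d" (is "?\<tau> \<in> _")
proof -
  have carr: "\<rho> \<in> carrier_mat d d" "\<sigma> \<in> carrier_mat d d"
    using \<rho> by (auto dest: density_ops_carrier)
  have psd: "psd d \<rho>" "psd d \<sigma>" and tr: "mat_trace \<rho> = 1" "mat_trace \<sigma> = 1"
    using \<rho> by (auto simp: density_ops_def)
  have "psd d ?\<tau>"
    unfolding psd_entries
  proof (intro conjI allI impI)
    show "?\<tau> \<in> carrier_mat d d" using carr by simp
    show "cnj (?\<tau> $$ (j, i)) = ?\<tau> $$ (i, j)" if "i < d" "j < d" for i j
      using carr that psd by (simp add: psd_entries)
    fix f :: "nat \<Rightarrow> complex"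
    define Q where "Q A = (\<Sum>i<d. \<Sum>j<d. A $$ (i, j) * f j * cnj (f i))" for A :: "complex mat"
    have "Q ?\<tau> = complex_of_real (1 - l) * Q \<rho> + complex_of_real l * Q \<sigma>"
    proof -
      have "Q ?\<tau> = (\<Sum>i<d. \<Sum>j<d. complex_of_real (1 - l) * (\<rho> $$ (i, j) * f j * cnj (f i))
          + complex_of_real l * (\<sigma> $$ (i, j) * f j * cnj (f i)))"
        unfolding Q_def using carr by (intro sum.cong refl) (simp add: algebra_simps)
      then show ?thesis
        by (simp only: Q_def sum.distrib sum_distrib_left)
    qed
    moreover have "0 \<le> Re (Q \<rho>)" "0 \<le> Re (Q \<sigma>)"
      unfolding Q_def by (rule psd_form_nonneg[OF psd(1)], rule psd_form_nonneg[OF psd(2)])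
    ultimately have "0 \<le> Re (Q ?\<tau>)"
      using l by simp
    then show "0 \<le> Re (\<Sum>i<d. \<Sum>j<d. ?\<tau> $$ (i, j) * f j * cnj (f i))"
      by (simp only: Q_def)
  qed
  moreover have "mat_trace ?\<tau> = complex_of_real (1 - l) * mat_trace \<rho> + complex_of_real l * mat_trace \<sigma>"
    using carr by (simp add: mat_trace_def sum_distrib_left sum.distrib)
  ultimately show ?thesis
    using tr by (simp add: density_ops_def)
qed

lemma trace_pairing_ket_bra:
  assumes "A \<in> carrier_mat d d"
  shows "trace_pairing (ket_bra (vec d f) (vec d f)) A = Re (\<Sum>i<d. \<Sum>j<d. A $$ (i, j) * f j * cnj (f i))"
proof -
  have "mat_trace (ket_bra (vec d f) (vec d f) * A) = (\<Sum>i<d. \<Sum>j<d. A $$ (j, i) * f i * cnj (f j))"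
    using assms by (subst mat_trace_mult[of _ d]) (auto simp: ket_bra_def intro!: sum.cong)
  then show ?thesis
    unfolding trace_pairing_def by (subst sum.swap) simp
qed

lemma cnj_mult_self: "z * cnj z = complex_of_real ((cmod z)\<^sup>2)"
  by (metis complex_norm_square)

lemma ket_bra_form:
  fixes f g :: "nat \<Rightarrow> complex"
  shows "(\<Sum>i<d. \<Sum>j<d. ket_bra (vec d f) (vec d f) $$ (i, j) * g j * cnj (g i))
    = complex_of_real ((cmod (\<Sum>i<d. cnj (f i) * g i))\<^sup>2)"
proof -
  have "(\<Sum>i<d. \<Sum>j<d. ket_bra (vec d f) (vec d f) $$ (i, j) * g j * cnj (g i))
    = (\<Sum>i<d. \<Sum>j<d. (f i * cnj (g i)) * (cnj (f j) * g j))"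
    by (intro sum.cong refl) (simp add: ket_bra_def)
  also have "\<dots> = (\<Sum>i<d. cnj (f i) * g i) * cnj (\<Sum>i<d. cnj (f i) * g i)"
    by (simp only: sum_product[symmetric] cnj_sum complex_cnj_mult complex_cnj_cnj mult.commute)
  finally show ?thesis
    by (simp only: cnj_mult_self)
qed

lemma psd_ket_bra: "psd d (ket_bra (vec d f) (vec d f))"
  unfolding psd_entries ket_bra_form by (auto simp: ket_bra_def)

lemma ket_bra_density:
  assumes "(\<Sum>i<d. (cmod (f i))\<^sup>2) = 1"
  shows "ket_bra (vec d f) (vec d f) \<in> density_ops d"
proof -
  have "mat_trace (ket_bra (vec d f) (vec d f)) = complex_of_real (\<Sum>i<d. (cmod (f i))\<^sup>2)"
    by (simp add: mat_trace_def ket_bra_def cnj_mult_self)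
  then show ?thesis
    using assms by (simp add: density_ops_def psd_ket_bra)
qed

text \<open>Normalising a nonzero test vector turns it into a rank-one state. Hermiticity has to be
  assumed: the real part in \<open>trace_pairing\<close> cannot detect it.\<close>

lemma psd_if_trace_pairing_nonneg:
  assumes carr: "A \<in> carrier_mat d d"
    and herm: "\<And>i j. i < d \<Longrightarrow> j < d \<Longrightarrow> cnj (A $$ (j, i)) = A $$ (i, j)"
    and pos: "\<And>\<rho>. \<rho> \<in> density_ops d \<Longrightarrow> 0 \<le> trace_pairing \<rho> A"
  shows "psd d A"
  unfolding psd_entries
proof (intro conjI allI impI)
  fix f :: "nat \<Rightarrow> complex"
  define Q where "Q f = Re (\<Sum>i<d. \<Sum>j<d. A $$ (i, j) * f j * cnj (f i))" for f
  define N where "N = (\<Sum>i<d. (cmod (f i))\<^sup>2)"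
  have "0 \<le> Q f"
  proof (cases "N = 0")
    case True
    then have "\<forall>i<d. f i = 0"
      unfolding N_def by (subst (asm) sum_nonneg_eq_0_iff) auto
    then show ?thesis by (simp add: Q_def)
  next
    case False
    then have "N > 0"
      unfolding N_def by (metis order_le_less sum_nonneg zero_le_power2)
    define g where "g i = f i / complex_of_real (sqrt N)" for i
    have "(\<Sum>i<d. (cmod (g i))\<^sup>2) = 1"
      using \<open>N > 0\<close> by (simp add: g_def norm_divide power_divide flip: sum_divide_distrib N_def)
    then have "0 \<le> Q g"
      using pos[OF ket_bra_density[where f = g and d = d]] by (simp add: trace_pairing_ket_bra[OF carr] Q_def)
    moreover have "A $$ (i, j) * f j * cnj (f i) = complex_of_real N * (A $$ (i, j) * g j * cnj (g i))" for i j
    proof -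
      have "complex_of_real (sqrt N) * complex_of_real (sqrt N) = complex_of_real N"
        using \<open>N > 0\<close> by (simp flip: of_real_mult)
      then show ?thesis
        using \<open>N > 0\<close> by (simp add: g_def)
    qed
    then have "(\<Sum>i<d. \<Sum>j<d. A $$ (i, j) * f j * cnj (f i))
        = complex_of_real N * (\<Sum>i<d. \<Sum>j<d. A $$ (i, j) * g j * cnj (g i))"
      by (simp only: sum_distrib_left)
    then have "Q f = N * Q g"
      by (simp add: Q_def)
    ultimately show ?thesis
      using \<open>N > 0\<close> by simp
  qed
  then show "0 \<le> Re (\<Sum>i<d. \<Sum>j<d. A $$ (i, j) * f j * cnj (f i))"
    by (simp add: Q_def)
qed (use carr herm in auto)

lemma unit_vec_norm:
  assumes "\<psi> \<in> carrier_vec d" "\<psi> \<bullet>c \<psi> = 1"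
  shows "(\<Sum>i<d. (cmod (\<psi> $ i))\<^sup>2) = 1"
proof -
  have "\<psi> \<bullet>c \<psi> = complex_of_real (\<Sum>i<d. (cmod (\<psi> $ i))\<^sup>2)"
    using assms(1) by (simp add: scalar_prod_def lessThan_atLeast0 cnj_mult_self)
  then show ?thesis
    using assms(2) by (metis of_real_eq_1_iff)
qed

text \<open>The form at \<open>g\<close> is the squared norm of \<open>g\<close> minus the squared
  overlap with the unit vector \<open>f\<close>, so this is Cauchy-Schwarz.\<close>

lemma psd_one_minus_ket_bra:
  assumes f: "(\<Sum>i<d. (cmod (f i))\<^sup>2) = 1"
  shows "psd d (1\<^sub>m d - ket_bra (vec d f) (vec d f))"
  unfolding psd_entries
proof (intro conjI allI impI)
  show "1\<^sub>m d - ket_bra (vec d f) (vec d f) \<in> carrier_mat d d"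
    by (simp add: ket_bra_def minus_carrier_mat)
  show "cnj ((1\<^sub>m d - ket_bra (vec d f) (vec d f)) $$ (j, i)) = (1\<^sub>m d - ket_bra (vec d f) (vec d f)) $$ (i, j)"
    if "i < d" "j < d" for i j
    using that by (simp add: ket_bra_def)
  fix g :: "nat \<Rightarrow> complex"
  have "(\<Sum>j<d. 1\<^sub>m d $$ (i, j) * g j * cnj (g i)) = complex_of_real ((cmod (g i))\<^sup>2)" if "i < d" for i
  proof -
    have "(\<Sum>j<d. 1\<^sub>m d $$ (i, j) * g j * cnj (g i)) = (\<Sum>j<d. if j = i then g i * cnj (g i) else 0)"
      using that by (intro sum.cong refl) auto
    then show ?thesis
      using that by (simp add: cnj_mult_self)
  qed
  then have id_form: "(\<Sum>i<d. \<Sum>j<d. 1\<^sub>m d $$ (i, j) * g j * cnj (g i)) = complex_of_real (\<Sum>i<d. (cmod (g i))\<^sup>2)"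
    by simp
  \<comment> \<open>The triangle inequality passes to moduli, where the real Cauchy-Schwarz
    inequality applies.\<close>
  have "(cmod (\<Sum>i<d. cnj (f i) * g i))\<^sup>2 \<le> (\<Sum>i<d. cmod (f i) * cmod (g i))\<^sup>2"
    by (intro power_mono order.trans[OF norm_sum]) (simp_all add: norm_mult)
  also have "\<dots> \<le> (\<Sum>i<d. (cmod (f i))\<^sup>2) * (\<Sum>i<d. (cmod (g i))\<^sup>2)"
    by (rule Cauchy_Schwarz_ineq_sum)
  finally have "(cmod (\<Sum>i<d. cnj (f i) * g i))\<^sup>2 \<le> (\<Sum>i<d. (cmod (g i))\<^sup>2)"
    using f by simp
  moreover have "(\<Sum>i<d. \<Sum>j<d. (1\<^sub>m d - ket_bra (vec d f) (vec d f)) $$ (i, j) * g j * cnj (g i))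
    = (\<Sum>i<d. \<Sum>j<d. 1\<^sub>m d $$ (i, j) * g j * cnj (g i))
      - (\<Sum>i<d. \<Sum>j<d. ket_bra (vec d f) (vec d f) $$ (i, j) * g j * cnj (g i))"
    unfolding sum_subtractf[symmetric]
    by (intro sum.cong refl) (simp add: ket_bra_def left_diff_distrib)
  ultimately show "0 \<le> Re (\<Sum>i<d. \<Sum>j<d. (1\<^sub>m d - ket_bra (vec d f) (vec d f)) $$ (i, j) * g j * cnj (g i))"
    unfolding id_form ket_bra_form by (simp flip: of_real_sum of_real_power)
qed

text \<open>The block constraints in scalar form: for \<open>q > 0\<close> the last condition is
  \<open>a\<^sup>2 / q \<le> y\<close>, for \<open>q = 0\<close> it forces \<open>a = 0\<close>,
  which is the support condition of admissibility, and for \<open>q = 1\<close> it is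
  \<open>a\<^sup>2 \<le> y\<close>.\<close>

lemma psd_2_iff:
  fixes y a q :: real
  shows "psd 2 (mat_of_rows_list 2 [[y, a], [a, q]]) \<longleftrightarrow> 0 \<le> y \<and> 0 \<le> q \<and> a\<^sup>2 \<le> y * q"
proof -
  let ?M = "mat_of_rows_list 2 [[y, a], [a, q]]"
  have carr: "?M \<in> carrier_mat 2 2" by (auto simp: mat_of_rows_list_def)
  have ent: "?M $$ (0, 0) = y" "?M $$ (0, Suc 0) = a" "?M $$ (Suc 0, 0) = a" "?M $$ (Suc 0, Suc 0) = q"
    by (simp_all add: mat_of_rows_list_def)
  have adj: "mat_adjoint ?M = ?M"
    unfolding mat_adjoint_eq_iff[OF carr] by (auto simp: less_2_cases_iff ent)
  have form: "(?M *\<^sub>v v) \<bullet>c v = y * (v $ 0)\<^sup>2 + 2 * a * v $ 0 * v $ 1 + q * (v $ 1)\<^sup>2"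
    if "v \<in> carrier_vec 2" for v
  proof -
    have "{..<2} = {0, Suc 0}" by auto
    then show ?thesis
      unfolding quadratic_form_sum[OF carr that that]
      by (simp add: ent power2_eq_square algebra_simps)
  qed
  have "psd 2 ?M \<longleftrightarrow> (\<forall>v0 v1. 0 \<le> y * v0\<^sup>2 + 2 * a * v0 * v1 + q * v1\<^sup>2)"
  proof
    assume L: "psd 2 ?M"
    show "\<forall>v0 v1. 0 \<le> y * v0\<^sup>2 + 2 * a * v0 * v1 + q * v1\<^sup>2"
    proof (intro allI)
      fix v0 v1 :: real
      have "vec_of_list [v0, v1] \<in> carrier_vec 2" by (simp add: carrier_dim_vec)
      then show "0 \<le> y * v0\<^sup>2 + 2 * a * v0 * v1 + q * v1\<^sup>2"
        using L form unfolding psd_def by fastforce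
    qed
  qed (unfold psd_def, intro conjI ballI carr adj, simp only: form)
  also have "\<dots> \<longleftrightarrow> 0 \<le> y \<and> 0 \<le> q \<and> a\<^sup>2 \<le> y * q"
  proof safe
    assume *: "\<forall>v0 v1. 0 \<le> y * v0\<^sup>2 + 2 * a * v0 * v1 + q * v1\<^sup>2"
    show y: "0 \<le> y" and q: "0 \<le> q"
      using *[rule_format, of 1 0] *[rule_format, of 0 1] by auto
    show "a\<^sup>2 \<le> y * q"
    proof (cases "q = 0")
      \<comment> \<open>At this test vector the form equals \<open>- 2 a\<^sup>2\<close>, whatever
        \<open>y\<close> is.\<close>
      case True
      then show ?thesis
        using *[rule_format, of a "- (y / 2) - 1"] by (simp add: power2_eq_square algebra_simps)
    next
      case False
      then have "0 \<le> q * (y * q - a\<^sup>2)"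
        using *[rule_format, of q "- a"] by (simp add: power2_eq_square algebra_simps)
      then show ?thesis using False q by (simp add: zero_le_mult_iff)
    qed
  next
    fix v0 v1 :: real assume *: "0 \<le> y" "0 \<le> q" "a\<^sup>2 \<le> y * q"
    show "0 \<le> y * v0\<^sup>2 + 2 * a * v0 * v1 + q * v1\<^sup>2"
    proof (cases "q = 0")
      case True
      then show ?thesis using * by simp
    next
      case False
      \<comment> \<open>Completing the square, multiplied by \<open>q\<close> to avoid a
        division.\<close>
      have "q * (y * v0\<^sup>2 + 2 * a * v0 * v1 + q * v1\<^sup>2) = (y * q - a\<^sup>2) * v0\<^sup>2 + (a * v0 + q * v1)\<^sup>2"
        by (simp add: power2_eq_square algebra_simps)
      moreover have "\<dots> \<ge> 0" using * by simp
      ultimately show ?thesis using False *(2) by (metis order_le_less zero_le_mult_iff not_le)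
    qed
  qed
  finally show ?thesis .
qed

subsection \<open>Statistics of the one-shot estimator\<close>

text \<open>Serves twice: for the Born probabilities, and to turn the real weights \<open>q\<close>
  of the program into a \<open>pmf\<close>.\<close>

lemma pmf_embed_finite:
  assumes "finite A" "\<And>x. x \<in> A \<Longrightarrow> 0 \<le> f x" "(\<Sum>x\<in>A. f x) = 1"
  shows "pmf (embed_pmf (\<lambda>x. if x \<in> A then f x else 0)) x = (if x \<in> A then f x else 0)"
proof (rule pmf_embed_pmf)
  have "(\<integral>\<^sup>+x. ennreal (if x \<in> A then f x else 0) \<partial>count_space UNIV)
      = (\<Sum>x\<in>A. ennreal (if x \<in> A then f x else 0))"
    using assms(1) by (intro nn_integral_count_space') auto
  also have "\<dots> = ennreal (\<Sum>x\<in>A. f x)"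
    using assms(2) by (simp add: sum_ennreal)
  finally show "(\<integral>\<^sup>+x. ennreal (if x \<in> A then f x else 0) \<partial>count_space UNIV) = 1"
    using assms(3) by simp
qed (use assms in auto)

lemma set_pmf_embed_finite:
  assumes "finite A" "\<And>x. x \<in> A \<Longrightarrow> 0 \<le> f x" "(\<Sum>x\<in>A. f x) = 1"
  shows "set_pmf (embed_pmf (\<lambda>x. if x \<in> A then f x else 0)) \<subseteq> A"
  using assms by (auto simp: set_pmf_eq pmf_embed_finite)

lemma mat_sum_carrier: "mat_sum d F I \<in> carrier_mat d d"
  by (simp add: mat_sum_def)

lemma weighted_effects_carrier: "weighted_effects n U B P c \<in> carrier_mat (2 ^ n) (2 ^ n)"
  by (simp add: weighted_effects_def mat_sum_carrier)

lemma trace_pairing_mat_sum: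
  assumes "A \<in> carrier_mat d d" "\<And>k. k \<in> I \<Longrightarrow> F k \<in> carrier_mat d d"
  shows "trace_pairing A (mat_sum d F I) = (\<Sum>k\<in>I. trace_pairing A (F k))"
proof -
  have "trace_pairing A (mat_sum d F I) = (\<Sum>i<d. \<Sum>j<d. \<Sum>k\<in>I. Re (A $$ (i, j) * F k $$ (j, i)))"
    unfolding trace_pairing_sum[OF assms(1) mat_sum_carrier]
    by (intro sum.cong refl) (simp add: mat_sum_def sum_distrib_left)
  also have "\<dots> = (\<Sum>i<d. \<Sum>k\<in>I. \<Sum>j<d. Re (A $$ (i, j) * F k $$ (j, i)))"
    by (intro sum.cong refl) (rule sum.swap)
  also have "\<dots> = (\<Sum>k\<in>I. \<Sum>i<d. \<Sum>j<d. Re (A $$ (i, j) * F k $$ (j, i)))"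
    by (rule sum.swap)
  also have "\<dots> = (\<Sum>k\<in>I. trace_pairing A (F k))"
    using assms by (intro sum.cong refl) (simp only: trace_pairing_sum[of _ d])
  finally show ?thesis .
qed

lemma ket_bra_carrier: "\<psi> \<in> carrier_vec d \<Longrightarrow> ket_bra \<psi> \<psi> \<in> carrier_mat d d"
  by (auto simp: ket_bra_def)

text \<open>Both \<open>O\<close> and \<open>I - O\<close> are positive semidefinite. Two values of
  \<open>tr (\<rho> O)\<close> thus differ by at most 1, which bounds the second-order error in the
  duality argument.\<close>

lemma ket_bra_pairing_bounds:
  assumes "\<psi> \<in> carrier_vec d" "\<psi> \<bullet>c \<psi> = 1" "\<rho> \<in> density_ops d"
  shows "0 \<le> trace_pairing \<rho> (ket_bra \<psi> \<psi>)" "trace_pairing \<rho> (ket_bra \<psi> \<psi>) \<le> 1"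
proof -
  have \<psi>: "ket_bra \<psi> \<psi> = ket_bra (vec d (($) \<psi>)) (vec d (($) \<psi>))"
  proof -
    have "vec d (($) \<psi>) = \<psi>"
      using assms(1) by (intro eq_vecI) auto
    then show ?thesis by simp
  qed
  have psd: "psd d \<rho>" and tr: "mat_trace \<rho> = 1"
    using assms(3) by (auto simp: density_ops_def)
  show "0 \<le> trace_pairing \<rho> (ket_bra \<psi> \<psi>)"
    unfolding \<psi> by (rule trace_pairing_nonneg[OF psd psd_ket_bra])
  have "0 \<le> trace_pairing \<rho> (1\<^sub>m d - ket_bra \<psi> \<psi>)"
    unfolding \<psi> using psd psd_one_minus_ket_bra[OF unit_vec_norm[OF assms(1,2)]]
    by (rule trace_pairing_nonneg)
  then show "trace_pairing \<rho> (ket_bra \<psi> \<psi>) \<le> 1"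
    using density_ops_carrier[OF assms(3)] assms(1) tr
    by (simp add: trace_pairing_diff_right[of _ d] ket_bra_carrier trace_pairing_one)
qed

text \<open>Excludes the value \<open>-\<infinity>\<close> for the supremum over states.\<close>

lemma density_ops_nonempty: "0 < d \<Longrightarrow> density_ops d \<noteq> {}"
proof -
  assume "0 < d"
  have "(\<Sum>i<d. (cmod (if i = 0 then 1 else 0))\<^sup>2) = (\<Sum>i<d. if i = 0 then 1 else 0)"
    by (intro sum.cong refl) simp
  also have "\<dots> = 1"
    using \<open>0 < d\<close> by simp
  finally show ?thesis
    using ket_bra_density[where d = d and f = "\<lambda>i. if i = 0 then 1 else 0"] by blast
qed

context
  fixes n :: nat
    and U :: "'u set"
    and B :: "'u \<Rightarrow> 'b set"
    and P :: "'u \<Rightarrow> 'b \<Rightarrow> complex mat"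
  assumes meas: "measurement_family n U B P"
begin

lemma finite_settings: "finite U" and finite_outcomes: "u \<in> U \<Longrightarrow> finite (B u)"
  and effect_psd: "u \<in> U \<Longrightarrow> b \<in> B u \<Longrightarrow> psd (2 ^ n) (P u b)"
  and effects_sum: "u \<in> U \<Longrightarrow> mat_sum (2 ^ n) (P u) (B u) = 1\<^sub>m (2 ^ n)"
  using meas by (auto simp: measurement_family_def)

lemma effect_carrier: "u \<in> U \<Longrightarrow> b \<in> B u \<Longrightarrow> P u b \<in> carrier_mat (2 ^ n) (2 ^ n)"
  using effect_psd by (auto simp: psd_def)

lemma trace_pairing_weighted_effects:
  assumes "\<rho> \<in> carrier_mat (2 ^ n) (2 ^ n)"
  shows "trace_pairing \<rho> (weighted_effects n U B P c) = (\<Sum>u\<in>U. \<Sum>b\<in>B u. c u b * trace_pairing \<rho> (P u b))"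
proof -
  have "trace_pairing \<rho> (weighted_effects n U B P c)
      = (\<Sum>(u, b)\<in>(SIGMA u:U. B u). trace_pairing \<rho> (complex_of_real (c u b) \<cdot>\<^sub>m P u b))"
    unfolding weighted_effects_def
    by (subst trace_pairing_mat_sum[OF assms]) (auto simp: effect_carrier case_prod_unfold)
  also have "\<dots> = (\<Sum>(u, b)\<in>(SIGMA u:U. B u). c u b * trace_pairing \<rho> (P u b))"
    by (intro sum.cong refl) (auto simp: trace_pairing_smult_right[OF assms] effect_carrier)
  also have "\<dots> = (\<Sum>u\<in>U. \<Sum>b\<in>B u. c u b * trace_pairing \<rho> (P u b))"
    using finite_settings finite_outcomes by (subst sum.Sigma) auto
  finally show ?thesis .
qed

text \<open>Real coefficients preserve Hermiticity, as \<open>psd_if_trace_pairing_nonneg\<close>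
  requires.\<close>

lemma weighted_effects_hermitian:
  assumes "i < 2 ^ n" "j < 2 ^ n"
  shows "cnj (weighted_effects n U B P c $$ (j, i)) = weighted_effects n U B P c $$ (i, j)"
proof -
  have "cnj ((complex_of_real (c u b) \<cdot>\<^sub>m P u b) $$ (j, i)) = (complex_of_real (c u b) \<cdot>\<^sub>m P u b) $$ (i, j)"
    if "u \<in> U" "b \<in> B u" for u b
    using effect_psd[OF that] effect_carrier[OF that] assms by (simp add: psd_entries)
  then show ?thesis
    using assms by (auto simp: weighted_effects_def mat_sum_def intro!: sum.cong)
qed

lemma born_nonneg:
  assumes "\<rho> \<in> density_ops (2 ^ n)" "u \<in> U" "b \<in> B u"
  shows "0 \<le> trace_pairing \<rho> (P u b)"
  using assms effect_psd by (auto simp: density_ops_def intro: trace_pairing_nonneg)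

lemma born_sum:
  assumes "\<rho> \<in> density_ops (2 ^ n)" "u \<in> U"
  shows "(\<Sum>b\<in>B u. trace_pairing \<rho> (P u b)) = 1"
proof -
  have "(\<Sum>b\<in>B u. trace_pairing \<rho> (P u b)) = trace_pairing \<rho> (mat_sum (2 ^ n) (P u) (B u))"
    using assms by (subst trace_pairing_mat_sum) (auto simp: density_ops_carrier effect_carrier)
  then show ?thesis
    using assms density_ops_carrier[OF assms(1)]
    by (simp add: effects_sum trace_pairing_one density_ops_def)
qed

lemma pmf_outcome:
  assumes "\<rho> \<in> density_ops (2 ^ n)" "u \<in> U"
  shows "pmf (outcome_pmf B P \<rho> u) b = (if b \<in> B u then trace_pairing \<rho> (P u b) else 0)"
    and "set_pmf (outcome_pmf B P \<rho> u) \<subseteq> B u"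
proof -
  note prob = finite_outcomes[OF assms(2)] born_nonneg[OF assms] born_sum[OF assms]
  show "pmf (outcome_pmf B P \<rho> u) b = (if b \<in> B u then trace_pairing \<rho> (P u b) else 0)"
    unfolding outcome_pmf_def trace_pairing_def[symmetric] by (rule pmf_embed_finite[OF prob])
  show "set_pmf (outcome_pmf B P \<rho> u) \<subseteq> B u"
    unfolding outcome_pmf_def trace_pairing_def[symmetric] by (rule set_pmf_embed_finite[OF prob])
qed

text \<open>Summing over all of \<open>U\<close>, not only over the support of \<open>q\<close>,
  allows a term-by-term comparison with \<open>trace_pairing_weighted_effects\<close>.\<close>

lemma expectation_sampling:
  fixes h :: "'u \<times> 'b \<Rightarrow> real"
  assumes \<rho>: "\<rho> \<in> density_ops (2 ^ n)" and q: "set_pmf q \<subseteq> U"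
  shows "measure_pmf.expectation (sampling_pmf B P q \<rho>) h
    = (\<Sum>u\<in>U. pmf q u * (\<Sum>b\<in>B u. h (u, b) * trace_pairing \<rho> (P u b)))"
proof -
  have fin: "finite (set_pmf (outcome_pmf B P \<rho> u))" if "u \<in> U" for u
    using pmf_outcome(2)[OF \<rho> that] finite_outcomes[OF that] by (rule finite_subset)
  have "measure_pmf.expectation (sampling_pmf B P q \<rho>) h
    = (\<Sum>u\<in>U. pmf q u *\<^sub>R measure_pmf.expectation (map_pmf (Pair u) (outcome_pmf B P \<rho> u)) h)"
    unfolding sampling_pmf_def
    by (rule pmf_expectation_bind) (use fin q finite_settings in auto)
  also have "\<dots> = (\<Sum>u\<in>U. pmf q u * (\<Sum>b\<in>B u. h (u, b) * trace_pairing \<rho> (P u b)))"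
  proof (intro sum.cong refl)
    fix u assume u: "u \<in> U"
    have "measure_pmf.expectation (map_pmf (Pair u) (outcome_pmf B P \<rho> u)) h
        = measure_pmf.expectation (outcome_pmf B P \<rho> u) (\<lambda>b. h (u, b))"
      by simp
    also have "\<dots> = (\<Sum>b\<in>B u. h (u, b) * pmf (outcome_pmf B P \<rho> u) b)"
      using pmf_outcome(2)[OF \<rho> u] finite_outcomes[OF u] by (intro integral_measure_pmf_real) auto
    finally show "pmf q u *\<^sub>R measure_pmf.expectation (map_pmf (Pair u) (outcome_pmf B P \<rho> u)) h
        = pmf q u * (\<Sum>b\<in>B u. h (u, b) * trace_pairing \<rho> (P u b))"
      by (simp add: pmf_outcome(1)[OF \<rho> u])
  qed
  finally show ?thesis .
qed

lemma finite_sampling: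
  assumes "\<rho> \<in> density_ops (2 ^ n)" "set_pmf q \<subseteq> U"
  shows "finite (set_pmf (sampling_pmf B P q \<rho>))"
proof (rule finite_subset)
  show "set_pmf (sampling_pmf B P q \<rho>) \<subseteq> (SIGMA u:U. B u)"
    using assms pmf_outcome(2)[OF assms(1)] by (auto simp: sampling_pmf_def)
  show "finite (SIGMA u:U. B u)"
    using finite_settings finite_outcomes by auto
qed

text \<open>The operator \<open>weighted_effects n U B P (\<lambda>u b. (\<alpha> u b)\<^sup>2 / pmf q u)\<close> below represents the second
  moment of the estimator; the settings with \<open>q(u) = 0\<close> contribute \<open>x / 0 = 0\<close> on both sides.\<close>

lemma one_shot_variance_eq:
  assumes \<rho>: "\<rho> \<in> density_ops (2 ^ n)" and adm: "admissible n U B P Obs q \<alpha>"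
  shows "one_shot_variance B P q \<alpha> \<rho>
    = trace_pairing \<rho> (weighted_effects n U B P (\<lambda>u b. (\<alpha> u b)\<^sup>2 / pmf q u)) - (trace_pairing \<rho> Obs)\<^sup>2"
proof -
  let ?X = "one_shot_estimator q \<alpha>" and ?M = "sampling_pmf B P q \<rho>"
  have q: "set_pmf q \<subseteq> U" and zero: "\<And>u b. u \<in> U \<Longrightarrow> b \<in> B u \<Longrightarrow> pmf q u = 0 \<Longrightarrow> \<alpha> u b = 0"
    and Obs: "weighted_effects n U B P \<alpha> = Obs"
    using adm by (auto simp: admissible_def)
  note carr = density_ops_carrier[OF \<rho>]
  \<comment> \<open>The support condition is essential here: a setting with \<open>q(u) = 0\<close>
    is never sampled but does occur in the unbiasedness identity, so its coefficients must
    vanish.\<close>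
  have "measure_pmf.expectation ?M ?X = trace_pairing \<rho> Obs"
    unfolding expectation_sampling[OF \<rho> q] Obs[symmetric] trace_pairing_weighted_effects[OF carr]
      sum_distrib_left
    using zero by (intro sum.cong refl) (auto simp: one_shot_estimator_def)
  moreover have "measure_pmf.expectation ?M (\<lambda>x. (?X x)\<^sup>2)
      = trace_pairing \<rho> (weighted_effects n U B P (\<lambda>u b. (\<alpha> u b)\<^sup>2 / pmf q u))"
    unfolding expectation_sampling[OF \<rho> q] trace_pairing_weighted_effects[OF carr] sum_distrib_left
    using zero by (intro sum.cong refl) (auto simp: one_shot_estimator_def power2_eq_square)
  ultimately show ?thesis
    unfolding one_shot_variance_def
    by (subst measure_pmf.variance_eq) (auto intro!: integrable_measure_pmf_finite finite_sampling \<rho> q)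
qed

subsection \<open>Duality\<close>

text \<open>Weak duality: \<open>- x\<^sup>2 \<le> t\<^sup>2 - 2 t x\<close> for \<open>x = tr (\<rho> O)\<close> and every \<open>t\<close>.\<close>

lemma sdp_feasible_variance_bound:
  assumes feas: "sdp_feasible n U B P Obs \<alpha> q y t \<gamma> s"
  obtains Q where "admissible n U B P Obs Q \<alpha>"
    and "\<And>\<rho>. \<rho> \<in> density_ops (2 ^ n) \<Longrightarrow> one_shot_variance B P Q \<alpha> \<rho> \<le> \<gamma> + s"
proof -
  \<comment> \<open>The program constrains \<open>q\<close> only on \<open>U\<close>; values outside
    are cut off.\<close>
  define Q where "Q = embed_pmf (\<lambda>u. if u \<in> U then q u else 0)"
  have Obs: "weighted_effects n U B P \<alpha> = Obs"
    and q: "\<And>u. u \<in> U \<Longrightarrow> 0 \<le> q u" "(\<Sum>u\<in>U. q u) = 1"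
    and y: "\<And>u b. u \<in> U \<Longrightarrow> b \<in> B u \<Longrightarrow> 0 \<le> y u b \<and> (\<alpha> u b)\<^sup>2 \<le> y u b * q u"
    and s: "t\<^sup>2 \<le> s"
    and psd: "psd (2 ^ n) (complex_of_real \<gamma> \<cdot>\<^sub>m 1\<^sub>m (2 ^ n)
      - (weighted_effects n U B P y - complex_of_real (2 * t) \<cdot>\<^sub>m Obs))"
    using feas by (auto simp: sdp_feasible_def psd_2_iff loewner_le_def)
  note prob = finite_settings q
  have Q: "pmf Q u = q u" if "u \<in> U" for u
    unfolding Q_def using pmf_embed_finite[OF prob] that by simp
  have adm: "admissible n U B P Obs Q \<alpha>"
    unfolding admissible_def
  proof (intro conjI ballI impI)
    show "set_pmf Q \<subseteq> U"
      unfolding Q_def by (rule set_pmf_embed_finite[OF prob])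
    show "\<alpha> u b = 0" if "u \<in> U" "pmf Q u = 0" "b \<in> B u" for u b
      using y[OF that(1,3)] that(2) Q[OF that(1)] by simp
  qed (rule Obs)
  moreover have "one_shot_variance B P Q \<alpha> \<rho> \<le> \<gamma> + s" if \<rho>: "\<rho> \<in> density_ops (2 ^ n)" for \<rho>
  proof -
    note carr = density_ops_carrier[OF \<rho>]
    have Obs_carr: "Obs \<in> carrier_mat (2 ^ n) (2 ^ n)"
      unfolding Obs[symmetric] by (rule weighted_effects_carrier)
    define x where "x = trace_pairing \<rho> Obs"
    define m where "m = trace_pairing \<rho> (weighted_effects n U B P (\<lambda>u b. (\<alpha> u b)\<^sup>2 / pmf Q u))"
    define z where "z = trace_pairing \<rho> (weighted_effects n U B P y)"
    have "m \<le> z"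
      unfolding m_def z_def trace_pairing_weighted_effects[OF carr]
    proof (intro sum_mono mult_right_mono)
      fix u b assume u: "u \<in> U" and b: "b \<in> B u"
      show "0 \<le> trace_pairing \<rho> (P u b)"
        by (rule born_nonneg[OF \<rho> u b])
      \<comment> \<open>For \<open>q u = 0\<close> the quotient is zero, and
        \<open>0 \<le> y u b\<close> suffices.\<close>
      show "(\<alpha> u b)\<^sup>2 / pmf Q u \<le> y u b"
        using y[OF u b] q(1)[OF u] Q[OF u] by (cases "q u = 0") (auto simp: divide_le_eq)
    qed
    moreover have "0 \<le> \<gamma> - (z - 2 * t * x)"
    proof -
      have "psd (2 ^ n) \<rho>" "mat_trace \<rho> = 1"
        using \<rho> by (auto simp: density_ops_def)
      then show ?thesis
        using trace_pairing_nonneg[OF _ psd, of \<rho>]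
        unfolding z_def x_def
        by (simp add: trace_pairing_diff_right[OF carr] trace_pairing_smult_right[OF carr] Obs_carr
            weighted_effects_carrier trace_pairing_one[OF carr] minus_carrier_mat del: of_real_mult)
    qed
    \<comment> \<open>This closes the chain \<open>m - x\<^sup>2 \<le> z - x\<^sup>2 \<le> \<gamma>
      + 2 t x - x\<^sup>2 \<le> \<gamma> + t\<^sup>2 \<le> \<gamma> + s\<close>.\<close>
    moreover have "0 \<le> (t - x)\<^sup>2" by simp
    moreover have "one_shot_variance B P Q \<alpha> \<rho> = m - x\<^sup>2"
      unfolding m_def x_def by (rule one_shot_variance_eq[OF \<rho> adm])
    ultimately show ?thesis
      using s by (simp add: power2_diff algebra_simps)
  qed
  ultimately show thesis by (rule that)
qed

text \<open>Strong duality without compactness: moving from an approximate maximiser \<open>\<rho>\<^sub>0\<close> of the concave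
  function \<open>tr (\<rho> M) - (tr (\<rho> O))\<^sup>2\<close> a step \<open>\<delta>\<close> towards any \<open>\<rho>\<close> gains at most \<open>\<delta>\<^sup>2\<close>, which makes the
  first-order optimality condition at \<open>\<rho>\<^sub>0\<close> hold up to \<open>2 \<delta>\<close>; it is the operator inequality of the
  program at \<open>t = tr (\<rho>\<^sub>0 O)\<close>.\<close>

lemma near_maximiser_sdp_feasible:
  assumes adm: "admissible n U B P Obs q \<alpha>"
    and x: "\<And>\<rho>. \<rho> \<in> density_ops (2 ^ n) \<Longrightarrow> 0 \<le> trace_pairing \<rho> Obs \<and> trace_pairing \<rho> Obs \<le> 1"
    and V: "\<And>\<rho>. \<rho> \<in> density_ops (2 ^ n) \<Longrightarrow> one_shot_variance B P q \<alpha> \<rho> \<le> V"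
    and \<rho>0: "\<rho>0 \<in> density_ops (2 ^ n)" "V - \<delta>\<^sup>2 \<le> one_shot_variance B P q \<alpha> \<rho>0"
    and \<delta>: "0 < \<delta>" "\<delta> \<le> 1"
  obtains y t \<gamma> s where "sdp_feasible n U B P Obs \<alpha> (pmf q) y t \<gamma> s" "\<gamma> + s \<le> V + 2 * \<delta>"
proof -
  define y where "y u b = (\<alpha> u b)\<^sup>2 / pmf q u" for u b
  define M where "M = weighted_effects n U B P y"
  define t where "t = trace_pairing \<rho>0 Obs"
  \<comment> \<open>The value of \<open>tr (\<rho> (M - 2 t O))\<close> at \<open>\<rho>0\<close>
    plus the slack \<open>2 \<delta>\<close>; adding \<open>s = t\<^sup>2\<close> gives the variance
    at \<open>\<rho>0\<close> plus \<open>2 \<delta>\<close>.\<close>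
  define \<gamma> where "\<gamma> = trace_pairing \<rho>0 M - 2 * t\<^sup>2 + 2 * \<delta>"
  have q: "set_pmf q \<subseteq> U" and zero: "\<And>u b. u \<in> U \<Longrightarrow> b \<in> B u \<Longrightarrow> pmf q u = 0 \<Longrightarrow> \<alpha> u b = 0"
    and Obs: "weighted_effects n U B P \<alpha> = Obs"
    using adm by (auto simp: admissible_def)
  have M_carr: "M \<in> carrier_mat (2 ^ n) (2 ^ n)" and Obs_carr: "Obs \<in> carrier_mat (2 ^ n) (2 ^ n)"
    unfolding M_def Obs[symmetric] by (rule weighted_effects_carrier)+
  have var: "one_shot_variance B P q \<alpha> \<rho> = trace_pairing \<rho> M - (trace_pairing \<rho> Obs)\<^sup>2"
    if "\<rho> \<in> density_ops (2 ^ n)" for \<rho>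
    unfolding M_def y_def by (rule one_shot_variance_eq[OF that adm])
  have optimality: "trace_pairing \<rho> M - 2 * t * trace_pairing \<rho> Obs \<le> \<gamma>" if \<rho>: "\<rho> \<in> density_ops (2 ^ n)" for \<rho>
  proof -
    note carr = density_ops_carrier[OF \<rho>] density_ops_carrier[OF \<rho>0(1)]
    define \<sigma> where "\<sigma> = complex_of_real (1 - \<delta>) \<cdot>\<^sub>m \<rho>0 + complex_of_real \<delta> \<cdot>\<^sub>m \<rho>"
    have \<sigma>: "\<sigma> \<in> density_ops (2 ^ n)"
      unfolding \<sigma>_def using \<delta> by (intro density_ops_convex \<rho> \<rho>0) auto
    have lin: "trace_pairing \<sigma> A = (1 - \<delta>) * trace_pairing \<rho>0 A + \<delta> * trace_pairing \<rho> A"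
      if A: "A \<in> carrier_mat (2 ^ n) (2 ^ n)" for A
      unfolding \<sigma>_def
      by (subst trace_pairing_add_left[OF _ _ A])
        (use carr A in \<open>simp_all add: trace_pairing_smult_left[of _ "2 ^ n"] del: of_real_diff\<close>)
    define dm where "dm = trace_pairing \<rho> M - trace_pairing \<rho>0 M"
    define dx where "dx = trace_pairing \<rho> Obs - t"
    have "\<bar>dx\<bar> \<le> 1"
      using x[OF \<rho>] x[OF \<rho>0(1)] by (auto simp: dx_def t_def)
    then have dx: "dx\<^sup>2 \<le> 1"
      by (simp add: abs_square_le_1)
    have "one_shot_variance B P q \<alpha> \<sigma> = trace_pairing \<rho>0 M + \<delta> * dm - (t + \<delta> * dx)\<^sup>2"
      unfolding var[OF \<sigma>] lin[OF M_carr] lin[OF Obs_carr] by (simp add: dm_def dx_def t_def algebra_simps)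
    \<comment> \<open>The deficit \<open>\<delta>\<^sup>2\<close> allowed at \<open>\<rho>0\<close>
      has the order of the quadratic term \<open>\<delta>\<^sup>2 dx\<^sup>2\<close>. Together they
      are at most \<open>2 \<delta>\<^sup>2\<close>, and dividing by the step length
      \<open>\<delta>\<close> leaves \<open>2 \<delta>\<close>.\<close>
    moreover have "one_shot_variance B P q \<alpha> \<sigma> \<le> trace_pairing \<rho>0 M - t\<^sup>2 + \<delta>\<^sup>2"
      using V[OF \<sigma>] \<rho>0(2) var[OF \<rho>0(1)] by (simp add: t_def)
    ultimately have "\<delta> * (dm - 2 * t * dx) \<le> \<delta>\<^sup>2 + \<delta>\<^sup>2 * dx\<^sup>2"
      by (simp add: power2_eq_square algebra_simps)
    also have "\<dots> \<le> \<delta> * (2 * \<delta>)"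
      using mult_left_mono[OF dx, of "\<delta>\<^sup>2"] by (simp add: power2_eq_square)
    finally have "dm - 2 * t * dx \<le> 2 * \<delta>"
      using \<delta>(1) by (simp only: mult_le_cancel_left_pos)
    then show ?thesis
      by (simp add: dm_def dx_def \<gamma>_def power2_eq_square algebra_simps)
  qed
  have "sdp_feasible n U B P Obs \<alpha> (pmf q) y t \<gamma> (t\<^sup>2)"
    unfolding sdp_feasible_def
  proof (intro conjI ballI)
    show "(\<Sum>u\<in>U. pmf q u) = 1"
      using finite_settings q by (rule sum_pmf_eq_1)
    \<comment> \<open>Where \<open>pmf q u = 0\<close>, admissibility and division by zero make the
      whole block zero.\<close>
    show "psd 2 (mat_of_rows_list 2 [[y u b, \<alpha> u b], [\<alpha> u b, pmf q u]])" if "u \<in> U" "b \<in> B u" for u b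
      using zero[OF that] by (cases "pmf q u = 0") (auto simp: psd_2_iff y_def)
    show "psd 2 (mat_of_rows_list 2 [[t\<^sup>2, t], [t, 1]])"
      by (simp add: psd_2_iff)
    define R where "R = complex_of_real \<gamma> \<cdot>\<^sub>m 1\<^sub>m (2 ^ n) - (M - complex_of_real (2 * t) \<cdot>\<^sub>m Obs)"
    have R_carr: "R \<in> carrier_mat (2 ^ n) (2 ^ n)"
      unfolding R_def using Obs_carr by (intro minus_carrier_mat) simp
    have "psd (2 ^ n) R"
    proof (rule psd_if_trace_pairing_nonneg[OF R_carr])
      fix i j :: nat assume ij: "i < 2 ^ n" "j < 2 ^ n"
      have "cnj (M $$ (j, i)) = M $$ (i, j)" "cnj (Obs $$ (j, i)) = Obs $$ (i, j)"
        unfolding M_def Obs[symmetric] using ij by (rule weighted_effects_hermitian)+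
      then show "cnj (R $$ (j, i)) = R $$ (i, j)"
        using ij M_carr Obs_carr by (simp add: R_def)
    next
      fix \<rho> :: "complex mat" assume \<rho>: "\<rho> \<in> density_ops (2 ^ n)"
      note carr = density_ops_carrier[OF \<rho>]
      have "mat_trace \<rho> = 1"
        using \<rho> by (simp add: density_ops_def)
      then have "trace_pairing \<rho> R = \<gamma> - (trace_pairing \<rho> M - 2 * t * trace_pairing \<rho> Obs)"
        unfolding R_def
        by (simp add: trace_pairing_diff_right[OF carr] trace_pairing_smult_right[OF carr] Obs_carr
            M_carr trace_pairing_one[OF carr] minus_carrier_mat del: of_real_mult)
      then show "0 \<le> trace_pairing \<rho> R"
        using optimality[OF \<rho>] by simp
    qed
    then show "loewner_le (2 ^ n) (weighted_effects n U B P y - complex_of_real (2 * t) \<cdot>\<^sub>m Obs)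
        (complex_of_real \<gamma> \<cdot>\<^sub>m 1\<^sub>m (2 ^ n))"
      using Obs_carr by (simp add: loewner_le_def R_def M_def minus_carrier_mat)
  qed (use Obs in auto)
  moreover have "\<gamma> + t\<^sup>2 \<le> V + 2 * \<delta>"
    using V[OF \<rho>0(1)] var[OF \<rho>0(1)] by (simp add: \<gamma>_def t_def)
  ultimately show thesis by (rule that)
qed

end

text \<open>Each inequality is checked point by point below an infimum in \<open>ereal\<close>, so
  an empty feasible set is covered without a separate case.\<close>

theorem theorem3:
  fixes n :: nat
    and U :: "'u set"
    and B :: "'u \<Rightarrow> 'b set"
    and P :: "'u \<Rightarrow> 'b \<Rightarrow> complex mat"
    and \<psi> :: "complex vec"
  assumes "measurement_family n U B P"
    and "\<psi> \<in> carrier_vec (2 ^ n)"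
    and "\<psi> \<bullet>c \<psi> = 1"
  shows "Gamma_star n U B P (ket_bra \<psi> \<psi>) = sdp_optimum n U B P (ket_bra \<psi> \<psi>)"
proof (rule antisym)
  let ?O = "ket_bra \<psi> \<psi>"
  show "Gamma_star n U B P ?O \<le> sdp_optimum n U B P ?O"
    unfolding sdp_optimum_def
  proof (rule INF_greatest, clarify)
    fix \<alpha> q y t \<gamma> s
    assume "sdp_feasible n U B P ?O \<alpha> q y t \<gamma> s"
    then obtain Q where adm: "admissible n U B P ?O Q \<alpha>"
      and bound: "\<And>\<rho>. \<rho> \<in> density_ops (2 ^ n) \<Longrightarrow> one_shot_variance B P Q \<alpha> \<rho> \<le> \<gamma> + s"
      using sdp_feasible_variance_bound[OF assms(1)] by metis
    have "Gamma_star n U B P ?O \<le> (SUP \<rho> \<in> density_ops (2 ^ n). ereal (one_shot_variance B P Q \<alpha> \<rho>))"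
      unfolding Gamma_star_def using adm by (intro INF_lower2[of "(Q, \<alpha>)"]) auto
    also have "\<dots> \<le> ereal (\<gamma> + s)"
      using bound by (intro SUP_least) simp
    finally show "Gamma_star n U B P ?O \<le> ereal (\<gamma> + s)" .
  qed
  show "sdp_optimum n U B P ?O \<le> Gamma_star n U B P ?O"
    unfolding Gamma_star_def
  proof (rule INF_greatest, clarify)
    fix q \<alpha> assume adm: "admissible n U B P ?O q \<alpha>"
    define S where "S = (SUP \<rho> \<in> density_ops (2 ^ n). ereal (one_shot_variance B P q \<alpha> \<rho>))"
    have upper: "ereal (one_shot_variance B P q \<alpha> \<rho>) \<le> S" if "\<rho> \<in> density_ops (2 ^ n)" for \<rho>
      unfolding S_def using that by (rule SUP_upper)
    show "sdp_optimum n U B P ?O \<le> (SUP \<rho> \<in> density_ops (2 ^ n). ereal (one_shot_variance B P q \<alpha> \<rho>))"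
      unfolding S_def[symmetric]
    proof (cases S)
      case (real V)
      show "sdp_optimum n U B P ?O \<le> S"
      proof (rule ereal_le_epsilon2)
        fix e :: real assume "0 < e"
        \<comment> \<open>\<open>\<delta> \<le> 1\<close> keeps the step inside the convex set of
          states, and \<open>\<delta> \<le> e / 2\<close> brings the loss \<open>2 \<delta>\<close>
          below \<open>e\<close>.\<close>
        define \<delta> where "\<delta> = min 1 (e / 2)"
        have \<delta>: "0 < \<delta>" "\<delta> \<le> 1" "2 * \<delta> \<le> e"
          using \<open>0 < e\<close> by (auto simp: \<delta>_def)
        have "ereal (V - \<delta>\<^sup>2) < S"
          using \<delta> real by simp
        then obtain \<rho>0 where \<rho>0: "\<rho>0 \<in> density_ops (2 ^ n)" "V - \<delta>\<^sup>2 \<le> one_shot_variance B P q \<alpha> \<rho>0"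
          unfolding S_def less_SUP_iff by (auto intro: less_imp_le)
        have "one_shot_variance B P q \<alpha> \<rho> \<le> V" if "\<rho> \<in> density_ops (2 ^ n)" for \<rho>
          using upper[OF that] real by simp
        then obtain y t \<gamma> s where feas: "sdp_feasible n U B P ?O \<alpha> (pmf q) y t \<gamma> s"
          and le: "\<gamma> + s \<le> V + 2 * \<delta>"
          using near_maximiser_sdp_feasible[OF assms(1) adm _ _ \<rho>0 \<delta>(1,2)]
            ket_bra_pairing_bounds[OF assms(2,3)] by metis
        have "sdp_optimum n U B P ?O \<le> ereal (\<gamma> + s)"
          unfolding sdp_optimum_def using feas by (intro INF_lower2[of "(\<alpha>, pmf q, y, t, \<gamma>, s)"]) auto
        also have "\<dots> \<le> S + ereal e"
          using le \<delta>(3) real by simp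
        finally show "sdp_optimum n U B P ?O \<le> S + ereal e" .
      qed
    next
      \<comment> \<open>Impossible: some state exists, and its variance is a real lower bound for
        \<open>S\<close>.\<close>
      case MInf
      obtain \<rho> where "\<rho> \<in> density_ops (2 ^ n :: nat)"
        using density_ops_nonempty[of "2 ^ n"] by auto
      then show "sdp_optimum n U B P ?O \<le> S"
        using upper MInf by fastforce
    qed simp
  qed
qed

end
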